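(* Let $h$ be a regularizer function on $\mathcal{C}$ that is $K$-strongly convex with respect to $\|\cdot\|$ (where $K>0$), and let $(\eta_n)_{n\geq1}$ be a positive nonincreasing sequence. Then, for every sequence of payoff vectors $(u_n)_{n\geq1}$ in $V^*$, the sequence of play given by $x_1=Q_h(0)$ and $x_{n+1}=Q_h\left(\eta_n\sum_{k=1}^n u_k\right)$ for $n\geq 1$ guarantees, for every $n\geq1$, $$\max_{x\in\mathcal{C}}\left(\sum_{k=1}^n\langle u_k|x\rangle-\sum_{k=1}^n\langle u_k|x_k\rangle\right)\leq\frac{h_{\max}-h_{\min}}{\eta_n}+\frac{1}{2K}\sum_{k=1}^n\eta_{k-1}\|u_k\|_*^2,$$ where $\eta_0=\eta_1$. In particular, if $\|u_n\|_*\leq M$ for all $n$ and some $M>0$, then for every $n\geq1$ $$\max_{x\in\mathcal{C}}\left(\sum_{k=1}^n\langle u_k|x\rangle-\sum_{k=1}^n\langle u_k|x_k\rangle\right)\leq\frac{h_{\max}-h_{\min}}{\eta_n}+\frac{M^2}{2K}\sum_{k=1}^n\eta_{k-1}.$$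
   Context: $V=\mathbb{R}^d$ is equipped with an arbitrary norm $\|\cdot\|$, $V^*$ is its dual with dual norm $\|y\|_*=\sup_{\|x\|\leq1}|\langle y|x\rangle|$, and $\langle y|x\rangle$ denotes the canonical pairing. $\mathcal{C}\subset V$ is a nonempty compact convex set. A convex function $h:V\to\mathbb{R}\cup\{+\infty\}$ is a regularizer function on $\mathcal{C}$ if its effective domain $\{x:h(x)<\infty\}$ equals $\mathcal{C}$ and $h|_{\mathcal{C}}$ is strictly convex and continuous. It is $K$-strongly convex w.r.t. $\|\cdot\|$ if $h(\lambda w_1+(1-\lambda)w_2)\leq\lambda h(w_1)+(1-\lambda)h(w_2)-\frac12K\lambda(1-\lambda)\|w_2-w_1\|^2$ for all $w_1,w_2\in V$ and $\lambda\in[0,1]$. The choice map $Q_h:V^*\to\mathcal{C}$ is $Q_h(y)=\arg\max_{x\in\mathcal{C}}\{\langle y|x\rangle-h(x)\}$ (the maximizer exists and is unique). $h_{\max}$ and $h_{\min}$ denote the maximum and minimum of $h$ over $\mathcal{C}$. *)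

theory Defs
  imports "HOL-Analysis.Analysis"
begin

text \<open>
  The ambient space carries two norms: the arbitrary norm of the problem, passed around
  explicitly as a function \<open>N\<close>, and the type-class norm, which only serves to provide the topology.
  In finite dimension all norms are equivalent, so compactness and continuity do not depend on the
  choice. The dual space is the type \<open>'a \<Rightarrow>\<^sub>L real\<close>; in finite dimension it contains all linear
  functionals, and the canonical pairing is \<^const>\<open>blinfun_apply\<close>.
\<close>

definition is_norm :: "('a::real_vector \<Rightarrow> real) \<Rightarrow> bool" where
  "is_norm N \<longleftrightarrow>
     (\<forall>x. 0 \<le> N x) \<and>
     (\<forall>x. N x = 0 \<longleftrightarrow> x = 0) \<and>
     (\<forall>c x. N (c *\<^sub>R x) = \<bar>c\<bar> * N x) \<and>
     (\<forall>x y. N (x + y) \<le> N x + N y)"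

definition dual_norm :: "('a::real_normed_vector \<Rightarrow> real) \<Rightarrow> ('a \<Rightarrow>\<^sub>L real) \<Rightarrow> real" where
  "dual_norm N y = (SUP x\<in>{x. N x \<le> 1}. \<bar>blinfun_apply y x\<bar>)"

text \<open>
  Functions with values in the reals extended by \<open>+\<infinity>\<close> are \<^typ>\<open>ereal\<close>-valued functions
  that never take the value \<open>-\<infinity>\<close>. Since \<open>0 * \<infinity> = 0\<close> in \<^typ>\<open>ereal\<close>, the
  endpoints \<open>t = 0\<close> and \<open>t = 1\<close> are harmless in the inequalities below.
\<close>

definition econvex :: "('a::real_vector \<Rightarrow> ereal) \<Rightarrow> bool" where
  "econvex h \<longleftrightarrow>
     (\<forall>x. h x \<noteq> -\<infinity>) \<and>
     (\<forall>x y t. 0 \<le> t \<and> t \<le> 1 \<longrightarrow>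
        h (t *\<^sub>R x + (1 - t) *\<^sub>R y) \<le> ereal t * h x + ereal (1 - t) * h y)"

definition strictly_econvex_on :: "'a::real_vector set \<Rightarrow> ('a \<Rightarrow> ereal) \<Rightarrow> bool" where
  "strictly_econvex_on C h \<longleftrightarrow>
     (\<forall>x\<in>C. \<forall>y\<in>C. \<forall>t. x \<noteq> y \<and> 0 < t \<and> t < 1 \<longrightarrow>
        h (t *\<^sub>R x + (1 - t) *\<^sub>R y) < ereal t * h x + ereal (1 - t) * h y)"

definition regularizer :: "'a::real_normed_vector set \<Rightarrow> ('a \<Rightarrow> ereal) \<Rightarrow> bool" where
  "regularizer C h \<longleftrightarrow>
     econvex h \<and> {x. h x < \<infinity>} = C \<and> strictly_econvex_on C h \<and> continuous_on C h"

definition strongly_convex ::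
  "('a::real_vector \<Rightarrow> real) \<Rightarrow> real \<Rightarrow> ('a \<Rightarrow> ereal) \<Rightarrow> bool" where
  "strongly_convex N K h \<longleftrightarrow>
     (\<forall>w1 w2 t. 0 \<le> t \<and> t \<le> 1 \<longrightarrow>
        h (t *\<^sub>R w1 + (1 - t) *\<^sub>R w2)
          \<le> ereal t * h w1 + ereal (1 - t) * h w2
              - ereal (1 / 2 * K * t * (1 - t) * (N (w2 - w1))\<^sup>2))"

definition choice_map ::
  "'a::real_normed_vector set \<Rightarrow> ('a \<Rightarrow> ereal) \<Rightarrow> ('a \<Rightarrow>\<^sub>L real) \<Rightarrow> 'a" where
  "choice_map C h y = arg_max (\<lambda>x. ereal (blinfun_apply y x) - h x) (\<lambda>x. x \<in> C)"

text \<open>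
  \<^const>\<open>Max\<close> and \<^const>\<open>Min\<close> are restricted to finite sets. The following are the attained
  maximum and minimum over an arbitrary set; they are unspecified if there is none.
\<close>

definition max_over :: "'a set \<Rightarrow> ('a \<Rightarrow> 'b::order) \<Rightarrow> 'b" where
  "max_over C f = (GREATEST v. v \<in> f ` C)"

definition min_over :: "'a set \<Rightarrow> ('a \<Rightarrow> 'b::order) \<Rightarrow> 'b" where
  "min_over C f = (LEAST v. v \<in> f ` C)"

definition h_max :: "'a set \<Rightarrow> ('a \<Rightarrow> ereal) \<Rightarrow> real" where
  "h_max C h = real_of_ereal (max_over C h)"

definition h_min :: "'a set \<Rightarrow> ('a \<Rightarrow> ereal) \<Rightarrow> real" where
  "h_min C h = real_of_ereal (min_over C h)"

definition max_regret ::
  "'a::real_normed_vector set \<Rightarrow> (nat \<Rightarrow> 'a \<Rightarrow>\<^sub>L real) \<Rightarrow> (nat \<Rightarrow> 'a) \<Rightarrow> nat \<Rightarrow> real" where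
  "max_regret C u x n =
     max_over C (\<lambda>z. (\<Sum>k=1..n. blinfun_apply (u k) z) - (\<Sum>k=1..n. blinfun_apply (u k) (x k)))"

end

theory Submission
  imports Defs
begin

text \<open>
  With \<open>S\<^sub>n = u\<^sub>1 + \<dots> + u\<^sub>n\<close>, the potential
  \<open>\<Phi>\<^sub>n = max\<^bsub>z \<in> C\<^esub> (\<langle>S\<^sub>n|z\<rangle> - (h z - h\<^sub>m\<^sub>i\<^sub>n) / \<eta>\<^sub>n)\<close> is attained at \<open>x\<^bsub>n+1\<^esub>\<close>. It starts
  at \<open>\<Phi>\<^sub>0 \<le> 0\<close> and dominates \<open>\<langle>S\<^sub>n|z\<rangle> - (h\<^sub>m\<^sub>a\<^sub>x - h\<^sub>m\<^sub>i\<^sub>n) / \<eta>\<^sub>n\<close>. Because \<open>\<eta>\<close> is nonincreasing and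
  \<open>\<Phi>\<^bsub>n-1\<^esub>\<close> decays quadratically away from its maximizer \<open>x\<^sub>n\<close>, its increment over
  \<open>\<langle>u\<^sub>n|x\<^sub>n\<rangle>\<close> is at most
  \<open>\<langle>u\<^sub>n|x\<^bsub>n+1\<^esub> - x\<^sub>n\<rangle> - K / (2 \<eta>\<^bsub>n-1\<^esub>) \<parallel>x\<^bsub>n+1\<^esub> - x\<^sub>n\<parallel>\<^sup>2 \<le> \<eta>\<^bsub>n-1\<^esub> / (2 K) \<parallel>u\<^sub>n\<parallel>\<^sub>*\<^sup>2\<close>.
\<close>

section \<open>The arbitrary norm and its dual norm\<close>

lemma is_norm_continuous:
  fixes N :: "'a::euclidean_space \<Rightarrow> real"
  assumes "is_norm N"
  shows "continuous_on UNIV N"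
proof -
  have "convex_on UNIV N"
  proof (rule convex_onI)
    fix t :: real and x y :: 'a
    assume "0 < t" "t < 1"
    moreover have "N ((1 - t) *\<^sub>R x + t *\<^sub>R y) \<le> N ((1 - t) *\<^sub>R x) + N (t *\<^sub>R y)"
      using assms unfolding is_norm_def by blast
    moreover have "N ((1 - t) *\<^sub>R x) = \<bar>1 - t\<bar> * N x" "N (t *\<^sub>R y) = \<bar>t\<bar> * N y"
      using assms unfolding is_norm_def by blast+
    ultimately show "N ((1 - t) *\<^sub>R x + t *\<^sub>R y) \<le> (1 - t) * N x + t * N y"
      by simp
  qed simp
  then show ?thesis
    by (rule convex_on_continuous[OF open_UNIV])
qed

text \<open>The constant is the minimum of \<open>N\<close> over the unit sphere, attained by
  compactness and hence positive; homogeneity carries the bound to all vectors.\<close>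

lemma is_norm_dominates_norm:
  fixes N :: "'a::euclidean_space \<Rightarrow> real"
  assumes N: "is_norm N"
  obtains c where "c > 0" "\<And>x. c * norm x \<le> N x"
proof -
  have "compact (sphere (0::'a) 1)" "sphere (0::'a) 1 \<noteq> {}"
    by auto
  moreover have "continuous_on (sphere 0 1) N"
    using is_norm_continuous[OF N] continuous_on_subset by blast
  ultimately obtain s where s: "s \<in> sphere 0 1" "\<And>y. y \<in> sphere 0 1 \<Longrightarrow> N s \<le> N y"
    by (meson continuous_attains_inf)
  show ?thesis
  proof
    have "N s \<noteq> 0" "0 \<le> N s"
      using N s(1) unfolding is_norm_def by auto
    then show "N s > 0"
      by simp
    fix x :: 'a
    show "N s * norm x \<le> N x"
    proof (cases "x = 0")
      case True
      then show ?thesis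
        using N unfolding is_norm_def by simp
    next
      case False
      then have "N s \<le> N ((1 / norm x) *\<^sub>R x)"
        by (intro s(2)) simp
      also have "\<dots> = N x / norm x"
        using N unfolding is_norm_def by simp
      finally show ?thesis
        using False by (simp add: field_simps)
    qed
  qed
qed

text \<open>A real \<open>SUP\<close> is an upper bound only over a set bounded above, so every
  estimate by \<open>dual_norm\<close> rests on this.\<close>

lemma bdd_above_dual_norm:
  fixes y :: "'a::euclidean_space \<Rightarrow>\<^sub>L real"
  assumes N: "is_norm N"
  shows "bdd_above ((\<lambda>x. \<bar>blinfun_apply y x\<bar>) ` {x. N x \<le> 1})"
proof -
  obtain c where c: "c > 0" "\<And>x. c * norm x \<le> N x"
    using is_norm_dominates_norm[OF N] by blast
  have "\<bar>blinfun_apply y x\<bar> \<le> norm y * (1 / c)" if "N x \<le> 1" for x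
  proof -
    have "c * norm x \<le> 1"
      using c(2)[of x] that by linarith
    then have "norm x \<le> 1 / c"
      using c(1) by (simp add: field_simps)
    then have "norm y * norm x \<le> norm y * (1 / c)"
      by (rule mult_left_mono) simp
    then show ?thesis
      using norm_blinfun[of y x] by simp
  qed
  then show ?thesis
    by (intro bdd_aboveI2) auto
qed

lemma dual_norm_nonneg:
  fixes y :: "'a::euclidean_space \<Rightarrow>\<^sub>L real"
  assumes N: "is_norm N"
  shows "0 \<le> dual_norm N y"
proof -
  have "N 0 = 0"
    using N unfolding is_norm_def by blast
  then have "\<bar>blinfun_apply y 0\<bar> \<le> dual_norm N y"
    unfolding dual_norm_def by (intro cSUP_upper bdd_above_dual_norm[OF N]) simp
  then show ?thesis
    by simp
qed

text \<open>A nonzero \<open>v\<close> scaled to \<open>N\<close>-length 1 competes in the supremum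
  defining \<open>dual_norm\<close>.\<close>

lemma abs_blinfun_le_dual_norm:
  fixes y :: "'a::euclidean_space \<Rightarrow>\<^sub>L real"
  assumes N: "is_norm N"
  shows "\<bar>blinfun_apply y v\<bar> \<le> dual_norm N y * N v"
proof (cases "v = 0")
  case True
  have "N 0 = 0"
    using N unfolding is_norm_def by blast
  with True show ?thesis
    by simp
next
  case False
  then have pos: "N v > 0"
    using N unfolding is_norm_def by (metis less_eq_real_def)
  moreover have "N ((1 / N v) *\<^sub>R v) = \<bar>1 / N v\<bar> * N v"
    using N unfolding is_norm_def by blast
  ultimately have "N ((1 / N v) *\<^sub>R v) = 1"
    by simp
  then have "\<bar>blinfun_apply y ((1 / N v) *\<^sub>R v)\<bar> \<le> dual_norm N y"
    unfolding dual_norm_def by (intro cSUP_upper bdd_above_dual_norm[OF N]) simp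
  then show ?thesis
    using pos by (simp add: blinfun.scaleR_right abs_mult field_simps)
qed

text \<open>This is the Fenchel-Young inequality for \<open>a / 2 * N\<^sup>2\<close>, obtained by
  expanding the square of \<open>dual_norm N y - a * N v\<close>.\<close>

lemma blinfun_diff_quadratic_le:
  fixes y :: "'a::euclidean_space \<Rightarrow>\<^sub>L real"
  assumes N: "is_norm N" and a: "a > 0"
  shows "blinfun_apply y v - a / 2 * (N v)\<^sup>2 \<le> (dual_norm N y)\<^sup>2 / (2 * a)"
proof -
  have "0 \<le> (dual_norm N y - a * N v)\<^sup>2 / (2 * a)"
    using a by simp
  also have "\<dots> = (dual_norm N y)\<^sup>2 / (2 * a) - dual_norm N y * N v + a / 2 * (N v)\<^sup>2"
    using a by (simp add: power2_eq_square field_simps)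
  finally show ?thesis
    using abs_blinfun_le_dual_norm[OF N, of y v] by linarith
qed

section \<open>Attained extrema and the choice map\<close>

lemma max_over_eq:
  fixes f :: "'a \<Rightarrow> 'b::order"
  assumes "z \<in> C" "\<And>y. y \<in> C \<Longrightarrow> f y \<le> f z"
  shows "max_over C f = f z"
  unfolding max_over_def using assms by (intro Greatest_equality) auto

lemma min_over_eq:
  fixes f :: "'a \<Rightarrow> 'b::order"
  assumes "z \<in> C" "\<And>y. y \<in> C \<Longrightarrow> f z \<le> f y"
  shows "min_over C f = f z"
  unfolding min_over_def using assms by (intro Least_equality) auto

lemma regularizer_finite:
  assumes "regularizer C h" "z \<in> C"
  shows "h z = ereal (real_of_ereal (h z))"
  using assms unfolding regularizer_def econvex_def by (cases "h z") auto

lemma regularizer_real_continuous: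
  assumes "regularizer C h"
  shows "continuous_on C (\<lambda>z. real_of_ereal (h z))"
proof -
  have "continuous_on C (\<lambda>z. ereal (real_of_ereal (h z))) \<longleftrightarrow> continuous_on C h"
    using regularizer_finite[OF assms] by (intro continuous_on_cong) auto
  then have "continuous_on C (\<lambda>z. ereal (real_of_ereal (h z)))"
    using assms unfolding regularizer_def by blast
  then show ?thesis
    by (simp add: continuous_on_iff_real o_def)
qed

lemma h_max_ge:
  assumes h: "regularizer C h" and "compact C" "z \<in> C"
  shows "real_of_ereal (h z) \<le> h_max C h"
proof -
  obtain m where m: "m \<in> C" "\<And>y. y \<in> C \<Longrightarrow> h y \<le> h m"
    using continuous_attains_sup[of C h] assms unfolding regularizer_def by blast
  have "max_over C h = h m"
    using m by (rule max_over_eq)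
  then show ?thesis
    unfolding h_max_def
    using m regularizer_finite[OF h] \<open>z \<in> C\<close> by (metis ereal_less_eq(3))
qed

lemma h_min_le:
  assumes h: "regularizer C h" and "compact C" "z \<in> C"
  shows "h_min C h \<le> real_of_ereal (h z)"
proof -
  obtain m where m: "m \<in> C" "\<And>y. y \<in> C \<Longrightarrow> h m \<le> h y"
    using continuous_attains_inf[of C h] assms unfolding regularizer_def by blast
  have "min_over C h = h m"
    using m by (rule min_over_eq)
  then show ?thesis
    unfolding h_min_def
    using m regularizer_finite[OF h] \<open>z \<in> C\<close> by (metis ereal_less_eq(3))
qed

text \<open>\<open>arg_max\<close> is a Hilbert choice, so its defining property holds once some
  maximizer is exhibited; compactness and continuity provide one.\<close>

lemma choice_map_maximizes:
  assumes h: "regularizer C h" and "compact C" "C \<noteq> {}"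
  shows "choice_map C h y \<in> C"
    and "z \<in> C \<Longrightarrow> blinfun_apply y z - real_of_ereal (h z)
           \<le> blinfun_apply y (choice_map C h y) - real_of_ereal (h (choice_map C h y))"
proof -
  define F where "F = (\<lambda>x. ereal (blinfun_apply y x) - h x)"
  define f where "f = (\<lambda>x. blinfun_apply y x - real_of_ereal (h x))"
  have Ff: "F x = ereal (f x)" if "x \<in> C" for x
    using regularizer_finite[OF h that] unfolding F_def f_def by (metis ereal_minus(1))
  have "continuous_on C f"
    unfolding f_def by (intro continuous_intros regularizer_real_continuous[OF h])
  then obtain m where m: "m \<in> C" "\<And>x. x \<in> C \<Longrightarrow> f x \<le> f m"
    using continuous_attains_sup[of C f] assms(2,3) by blast
  then have "is_arg_max F (\<lambda>x. x \<in> C) m"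
    by (simp add: is_arg_max_linorder Ff)
  then have "is_arg_max F (\<lambda>x. x \<in> C) (choice_map C h y)"
    unfolding choice_map_def arg_max_def F_def by (rule someI)
  then have *: "choice_map C h y \<in> C" "\<And>z. z \<in> C \<Longrightarrow> F z \<le> F (choice_map C h y)"
    by (auto simp: is_arg_max_linorder)
  show "choice_map C h y \<in> C"
    by (rule *(1))
  show "blinfun_apply y z - real_of_ereal (h z)
      \<le> blinfun_apply y (choice_map C h y) - real_of_ereal (h (choice_map C h y))" if "z \<in> C"
    using *(2)[OF that] that *(1) by (simp add: Ff) (simp add: f_def)
qed

section \<open>Strong convexity and quadratic growth at a maximizer\<close>

lemma strongly_convex_real:
  assumes h: "regularizer C h" and sc: "strongly_convex N K h" and "convex C"
    and "w1 \<in> C" "w2 \<in> C" "0 \<le> t" "t \<le> 1"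
  shows "real_of_ereal (h (t *\<^sub>R w1 + (1 - t) *\<^sub>R w2))
           \<le> t * real_of_ereal (h w1) + (1 - t) * real_of_ereal (h w2)
             - 1 / 2 * K * t * (1 - t) * (N (w2 - w1))\<^sup>2"
proof -
  have "t *\<^sub>R w1 + (1 - t) *\<^sub>R w2 \<in> C"
    using assms by (intro convexD) auto
  note fin = regularizer_finite[OF h this] regularizer_finite[OF h \<open>w1 \<in> C\<close>]
    regularizer_finite[OF h \<open>w2 \<in> C\<close>]
  have "h (t *\<^sub>R w1 + (1 - t) *\<^sub>R w2)
      \<le> ereal t * h w1 + ereal (1 - t) * h w2
        - ereal (1 / 2 * K * t * (1 - t) * (N (w2 - w1))\<^sup>2)"
    using sc assms(6,7) unfolding strongly_convex_def by blast
  then show ?thesis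
    by (subst (asm) (1) fin(1), subst (asm) fin(2), subst (asm) fin(3)) simp
qed

text \<open>A point a fraction \<open>t\<close> of the way from \<open>p\<close> to \<open>z\<close>
  cannot beat \<open>p\<close>. Strong convexity bounds its value from below, and dividing by
  \<open>t\<close> leaves an inequality that can be taken to the limit.\<close>

lemma maximizer_quadratic_growth:
  assumes h: "regularizer C h" and sc: "strongly_convex N K h" and C: "convex C"
    and p: "p \<in> C" and z: "z \<in> C"
    and max: "\<And>w. w \<in> C \<Longrightarrow> blinfun_apply y w - real_of_ereal (h w)
                \<le> blinfun_apply y p - real_of_ereal (h p)"
  shows "blinfun_apply y z - real_of_ereal (h z) + K / 2 * (N (z - p))\<^sup>2
           \<le> blinfun_apply y p - real_of_ereal (h p)"
proof -
  define F where "F = (\<lambda>w. blinfun_apply y w - real_of_ereal (h w))"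
  define B where "B = K / 2 * (N (z - p))\<^sup>2"
  have step: "F z + (1 - t) * B \<le> F p" if "0 < t" "t < 1" for t
  proof -
    let ?w = "(1 - t) *\<^sub>R p + t *\<^sub>R z"
    have "?w \<in> C"
      using C p z that by (intro convexD) auto
    then have "F ?w \<le> F p"
      unfolding F_def by (rule max)
    moreover have "blinfun_apply y ?w = (1 - t) * blinfun_apply y p + t * blinfun_apply y z"
      by (simp add: blinfun.add_right blinfun.scaleR_right)
    then have "t * F z + (1 - t) * F p + t * ((1 - t) * B) \<le> F ?w"
      using strongly_convex_real[OF h sc C p z, of "1 - t"] that
      unfolding F_def B_def by (simp add: algebra_simps del: scaleR_left_diff_distrib)
    ultimately have "t * (F z + (1 - t) * B) \<le> t * F p"
      by (simp add: algebra_simps)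
    then show ?thesis
      using that(1) by simp
  qed
  \<comment> \<open>Each fixed \<open>t\<close> loses a factor \<open>1 - t\<close>; letting
    \<open>t\<close> tend to 0 recovers the full constant \<open>K / 2\<close>.\<close>
  have "((\<lambda>t. F z + (1 - t) * B) \<longlongrightarrow> F z + (1 - 0) * B) (at_right 0)"
    by (intro tendsto_intros)
  moreover have "\<forall>\<^sub>F t in at_right 0. F z + (1 - t) * B \<le> F p"
    using step unfolding eventually_at_right_field by (intro exI[of _ 1]) auto
  ultimately have "F z + (1 - 0) * B \<le> F p"
    by (intro tendsto_upperbound) auto
  then show ?thesis
    unfolding F_def B_def by simp
qed

section \<open>The potential argument for a fixed competitor\<close>

lemma regret_le:
  fixes N :: "'a::euclidean_space \<Rightarrow> real"
  assumes N: "is_norm N"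
    and C: "C \<noteq> {}" "compact C" "convex C"
    and h: "regularizer C h"
    and K: "K > 0" "strongly_convex N K h"
    and \<eta>_pos: "\<And>n. \<eta> n > 0" and \<eta>_dec: "\<And>n. \<eta> (Suc n) \<le> \<eta> n"
    and x: "\<And>n. x (Suc n) = choice_map C h (\<eta> n *\<^sub>R (\<Sum>k=1..n. u k))"
    and z: "z \<in> C"
  shows "(\<Sum>k=1..n. blinfun_apply (u k) z) - (\<Sum>k=1..n. blinfun_apply (u k) (x k))
           \<le> (h_max C h - h_min C h) / \<eta> n
             + 1 / (2 * K) * (\<Sum>k=1..n. \<eta> (k - 1) * (dual_norm N (u k))\<^sup>2)"
proof -
  define S where "S = (\<lambda>n. \<Sum>k=1..n. u k)"
  \<comment> \<open>Shifting \<open>h\<close> to a nonnegative \<open>g\<close> makes the penalty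
    \<open>g / \<eta>\<close> grow as \<eta> shrinks.\<close>
  define g where "g = (\<lambda>w. real_of_ereal (h w) - h_min C h)"
  define \<phi> where "\<phi> = (\<lambda>n w. blinfun_apply (S n) w - g w / \<eta> n)"
  have xC: "x (Suc n) \<in> C" for n
    unfolding x by (rule choice_map_maximizes(1)[OF h C(2,1)])
  \<comment> \<open>\<open>\<eta> n * \<phi> n\<close> is the objective of the choice map up to a
    constant, so dividing by \<open>\<eta> n\<close> turns the modulus \<open>K\<close> into
    \<open>K / \<eta> n\<close>.\<close>
  have growth: "\<phi> n w + K / (2 * \<eta> n) * (N (w - x (Suc n)))\<^sup>2 \<le> \<phi> n (x (Suc n))"
    if "w \<in> C" for n w
  proof -
    let ?p = "x (Suc n)"
    have "blinfun_apply (\<eta> n *\<^sub>R S n) w - real_of_ereal (h w) + K / 2 * (N (w - ?p))\<^sup>2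
        \<le> blinfun_apply (\<eta> n *\<^sub>R S n) ?p - real_of_ereal (h ?p)"
      unfolding x S_def
      by (intro maximizer_quadratic_growth[OF h K(2) C(3) _ that] choice_map_maximizes[OF h C(2,1)])
    then have "(\<eta> n * blinfun_apply (S n) w - g w + K / 2 * (N (w - ?p))\<^sup>2) / \<eta> n
        \<le> (\<eta> n * blinfun_apply (S n) ?p - g ?p) / \<eta> n"
      using \<eta>_pos[of n] unfolding g_def
      by (intro divide_right_mono) (simp_all add: blinfun.scaleR_left)
    then show ?thesis
      using \<eta>_pos[of n] unfolding \<phi>_def by (simp add: add_divide_distrib diff_divide_distrib mult.commute)
  qed
  have potential: "\<phi> n (x (Suc n))
      \<le> (\<Sum>k=1..n. blinfun_apply (u k) (x k))
        + 1 / (2 * K) * (\<Sum>k=1..n. \<eta> (k - 1) * (dual_norm N (u k))\<^sup>2)" for n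
  proof (induction n)
    case 0
    \<comment> \<open>\<open>S 0 = 0\<close>, so only the nonpositive penalty remains.\<close>
    have "0 \<le> g (x 1) / \<eta> 0"
      using h_min_le[OF h C(2) xC[of 0]] \<eta>_pos[of 0] unfolding g_def by simp
    then show ?case
      unfolding \<phi>_def S_def by simp
  next
    case (Suc n)
    define p where "p = x (Suc (Suc n))"
    define q where "q = x (Suc n)"
    have "0 \<le> g p"
      using h_min_le[OF h C(2) xC] unfolding g_def p_def by simp
    \<comment> \<open>Monotonicity of \<eta> enters here: the new potential is compared with the old
      one at the same point \<open>p\<close>.\<close>
    then have "g p / \<eta> n \<le> g p / \<eta> (Suc n)"
      by (intro divide_left_mono \<eta>_dec mult_pos_pos \<eta>_pos)
    then have "\<phi> (Suc n) p \<le> \<phi> n p + blinfun_apply (u (Suc n)) p"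
      unfolding \<phi>_def S_def by (simp add: blinfun.add_left)
    also have "\<dots> \<le> \<phi> n q + blinfun_apply (u (Suc n)) q
        + (blinfun_apply (u (Suc n)) (p - q) - (K / \<eta> n) / 2 * (N (p - q))\<^sup>2)"
      using growth[OF xC, of n "Suc n"] unfolding p_def q_def by (simp add: blinfun.diff_right)
    \<comment> \<open>Fenchel-Young with \<open>a = K / \<eta> n\<close>. For
      \<open>k = Suc n\<close> the rate \<open>\<eta> n\<close> is \<open>\<eta> (k - 1)\<close>,
      whence the index shift in the bound.\<close>
    also have "\<dots> \<le> \<phi> n q + blinfun_apply (u (Suc n)) q
        + \<eta> n * (dual_norm N (u (Suc n)))\<^sup>2 / (2 * K)"
      using blinfun_diff_quadratic_le[OF N, of "K / \<eta> n" "u (Suc n)" "p - q"] K(1) \<eta>_pos[of n]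
      by (simp add: mult.commute)
    finally show ?case
      using Suc.IH unfolding p_def q_def by (simp add: algebra_simps)
  qed
  have "g z / \<eta> n \<le> (h_max C h - h_min C h) / \<eta> n"
    using h_max_ge[OF h C(2) z] \<eta>_pos[of n] unfolding g_def by (intro divide_right_mono) auto
  moreover have "\<phi> n z \<le> \<phi> n (x (Suc n))"
    using growth[OF z, of n] K(1) \<eta>_pos[of n]
    by (smt (verit) divide_nonneg_pos mult_nonneg_nonneg zero_le_power2)
  moreover have "blinfun_apply (S n) z = (\<Sum>k=1..n. blinfun_apply (u k) z)"
    unfolding S_def by (simp add: blinfun.sum_left)
  ultimately show ?thesis
    using potential[of n] unfolding \<phi>_def by linarith
qed

text \<open>\<open>max_over\<close> is specified only when a greatest value exists; the regret is
  continuous in the competitor, so compactness supplies it.\<close>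

lemma max_regret_le:
  assumes "compact C" "C \<noteq> {}"
    and "\<And>z. z \<in> C \<Longrightarrow> (\<Sum>k=1..n. blinfun_apply (u k) z) - (\<Sum>k=1..n. blinfun_apply (u k) (x k)) \<le> B"
  shows "max_regret C u x n \<le> B"
proof -
  let ?r = "\<lambda>z. (\<Sum>k=1..n. blinfun_apply (u k) z) - (\<Sum>k=1..n. blinfun_apply (u k) (x k))"
  have "continuous_on C ?r"
    by (intro continuous_intros)
  then obtain m where m: "m \<in> C" "\<And>z. z \<in> C \<Longrightarrow> ?r z \<le> ?r m"
    using continuous_attains_sup[of C ?r] assms(1,2) by blast
  show ?thesis
    unfolding max_regret_def using assms(3)[OF m(1)] max_over_eq[of m C ?r] m by simp
qed

theorem theorem5p1:
  fixes N :: "real ^ 'd \<Rightarrow> real"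
    and C :: "(real ^ 'd) set"
    and h :: "real ^ 'd \<Rightarrow> ereal"
    and K :: real
    and \<eta> :: "nat \<Rightarrow> real"
    and u :: "nat \<Rightarrow> (real ^ 'd) \<Rightarrow>\<^sub>L real"
    and x :: "nat \<Rightarrow> real ^ 'd"
  assumes "is_norm N"
    and "C \<noteq> {}" and "compact C" and "convex C"
    and "regularizer C h"
    and "K > 0" and "strongly_convex N K h"
    and "\<forall>n\<ge>1. \<eta> n > 0" and "antimono_on {1..} \<eta>" and "\<eta> 0 = \<eta> 1"
    and "x 1 = choice_map C h 0"
    and "\<forall>n\<ge>1. x (n + 1) = choice_map C h (\<eta> n *\<^sub>R (\<Sum>k=1..n. u k))"
  shows "(\<forall>n\<ge>1. max_regret C u x n
            \<le> (h_max C h - h_min C h) / \<eta> n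
                + 1 / (2 * K) * (\<Sum>k=1..n. \<eta> (k - 1) * (dual_norm N (u k))\<^sup>2))
       \<and> (\<forall>M>0. (\<forall>n\<ge>1. dual_norm N (u n) \<le> M) \<longrightarrow>
            (\<forall>n\<ge>1. max_regret C u x n
              \<le> (h_max C h - h_min C h) / \<eta> n
                  + M\<^sup>2 / (2 * K) * (\<Sum>k=1..n. \<eta> (k - 1))))"
proof -
  \<comment> \<open>The convention \<open>\<eta> 0 = \<eta> 1\<close> extends the hypotheses on
    \<eta> to index 0, and \<open>x 1\<close> fits the recursion there because the empty sum is
    0.\<close>
  have dec: "\<eta> (Suc n) \<le> \<eta> n" for n
    using assms(9,10) by (cases n) (auto simp: monotone_on_def)
  have pos: "\<eta> n > 0" for n
    using assms(8,10) by (cases n) auto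
  have x: "x (Suc n) = choice_map C h (\<eta> n *\<^sub>R (\<Sum>k=1..n. u k))" for n
    using assms(11,12) by (cases n) auto
  have bound: "max_regret C u x n
      \<le> (h_max C h - h_min C h) / \<eta> n
        + 1 / (2 * K) * (\<Sum>k=1..n. \<eta> (k - 1) * (dual_norm N (u k))\<^sup>2)" for n
    using assms pos dec x by (intro max_regret_le regret_le)
  have "max_regret C u x n
      \<le> (h_max C h - h_min C h) / \<eta> n + M\<^sup>2 / (2 * K) * (\<Sum>k=1..n. \<eta> (k - 1))"
    if M: "\<forall>n\<ge>1. dual_norm N (u n) \<le> M" for M n
  proof -
    \<comment> \<open>Squaring the bound by \<open>M\<close> is monotone because dual norms are
      nonnegative.\<close>
    have "(\<Sum>k=1..n. \<eta> (k - 1) * (dual_norm N (u k))\<^sup>2) \<le> (\<Sum>k=1..n. \<eta> (k - 1) * M\<^sup>2)"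
      using M dual_norm_nonneg[OF assms(1)] pos
      by (intro sum_mono mult_left_mono power_mono) (auto simp: less_imp_le)
    then have "1 / (2 * K) * (\<Sum>k=1..n. \<eta> (k - 1) * (dual_norm N (u k))\<^sup>2)
        \<le> 1 / (2 * K) * (\<Sum>k=1..n. \<eta> (k - 1) * M\<^sup>2)"
      using assms(6) by (intro mult_left_mono) auto
    also have "\<dots> = M\<^sup>2 / (2 * K) * (\<Sum>k=1..n. \<eta> (k - 1))"
      by (simp add: sum_distrib_right[symmetric])
    finally show ?thesis
      using bound[of n] by linarith
  qed
  with bound show ?thesis
    by blast
qed

end
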